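(* Let $L>0$, let $F:\mathbb{R}^d\to\mathbb{R}^d$ be a $\frac1L$-cocoercive operator, and let $\boldsymbol{u}^*\in\mathbb{R}^d$ be such that $F(\boldsymbol{u}^* )=\mathbf{0}$. Let $\boldsymbol{u}_0\in\mathbb{R}^d$ be arbitrary and let $\boldsymbol{u}_{k+1}=\boldsymbol{u}_k-\frac1LF(\boldsymbol{u}_k)$ for $k\ge0$. Then, for all $k\ge1$, $$\|F(\boldsymbol{u}_k)\|\le\frac{L\|\boldsymbol{u}_0-\boldsymbol{u}^*\|}{\sqrt{k/2+1}}.$$
   Context: $\|\cdot\| = \sqrt{\langle\cdot,\cdot\rangle}$ is the norm induced by an inner product on $\mathbb{R}^d$. $F$ is $\frac1L$-cocoercive if $\langle F(\boldsymbol{u})-F(\boldsymbol{v}),\boldsymbol{u}-\boldsymbol{v}\rangle\ge\frac1L\|F(\boldsymbol{u})-F(\boldsymbol{v})\|^2$ for all $\boldsymbol{u},\boldsymbol{v}\in\mathbb{R}^d$. *)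

theory Defs
  imports "HOL-Analysis.Analysis"
begin

text \<open>The inner product on \<open>\<real>\<^sup>d\<close> is arbitrary, not just the standard one \<open>(\<bullet>)\<close> fixed by
  the type class instance; hence it is a parameter, and so is everything derived from it.\<close>

definition inner_product_on_Rd :: "(real ^ 'd \<Rightarrow> real ^ 'd \<Rightarrow> real) \<Rightarrow> bool" where
  "inner_product_on_Rd ip \<longleftrightarrow>
     bilinear ip \<and> (\<forall>x y. ip x y = ip y x) \<and> (\<forall>x. x \<noteq> 0 \<longrightarrow> ip x x > 0)"

definition induced_norm :: "(real ^ 'd \<Rightarrow> real ^ 'd \<Rightarrow> real) \<Rightarrow> real ^ 'd \<Rightarrow> real" where
  "induced_norm ip x = sqrt (ip x x)"

definition cocoercive ::
    "(real ^ 'd \<Rightarrow> real ^ 'd \<Rightarrow> real) \<Rightarrow> real \<Rightarrow> (real ^ 'd \<Rightarrow> real ^ 'd) \<Rightarrow> bool" where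
  "cocoercive ip \<beta> F \<longleftrightarrow>
     (\<forall>u v. ip (F u - F v) (u - v) \<ge> \<beta> * (induced_norm ip (F u - F v))\<^sup>2)"

end

theory Submission
  imports Defs
begin

text \<open>
  Write \<open>\<parallel>x\<parallel>\<^sup>2\<close> for \<open>ip x x\<close>. Each step does two things. Cocoercivity between the current iterate
  and the zero \<open>u\<^sup>*\<close> makes \<open>L\<^sup>2 \<parallel>u\<^sub>k - u\<^sup>*\<parallel>\<^sup>2\<close> drop by at least \<open>\<parallel>F u\<^sub>k\<parallel>\<^sup>2\<close>
  (\<open>step_decreases_distance\<close>), and cocoercivity between consecutive iterates keeps
  \<open>\<parallel>F u\<^sub>k\<parallel>\<close> from growing (\<open>step_residual_antimono\<close>). Hence the potential
  \<open>k \<parallel>F u\<^sub>k\<parallel>\<^sup>2 + L\<^sup>2 \<parallel>u\<^sub>k - u\<^sup>*\<parallel>\<^sup>2\<close> never increases: what its first term gains when \<open>k\<close> becomes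
  \<open>k + 1\<close> is paid for by the drop in distance. Since the distance cannot drop below zero, one more
  such drop gives \<open>(k + 1) \<parallel>F u\<^sub>k\<parallel>\<^sup>2 \<le> L\<^sup>2 \<parallel>u\<^sub>0 - u\<^sup>*\<parallel>\<^sup>2\<close>, and \<open>k / 2 + 1 \<le> k + 1\<close>.
\<close>

lemma inner_product_nonneg:
  assumes "inner_product_on_Rd ip"
  shows "0 \<le> ip x x"
  using assms unfolding inner_product_on_Rd_def
  by (metis bilinear_lzero less_eq_real_def)

lemma inner_product_diff_scaleR_self:
  assumes "inner_product_on_Rd ip"
  shows "ip (x - c *\<^sub>R y) (x - c *\<^sub>R y) = ip x x - 2 * c * ip y x + c\<^sup>2 * ip y y"
proof -
  have bil: "bilinear ip" and sym: "ip x y = ip y x"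
    using assms by (auto simp: inner_product_on_Rd_def)
  show ?thesis
    by (simp add: bilinear_lsub[OF bil] bilinear_rsub[OF bil] bilinear_lmul[OF bil]
        bilinear_rmul[OF bil] sym power2_eq_square algebra_simps)
qed

lemma cocoerciveD:
  assumes "inner_product_on_Rd ip" and "L > 0" and "cocoercive ip (1 / L) F"
  shows "ip (F x - F y) (F x - F y) \<le> L * ip (F x - F y) (x - y)"
proof -
  have "(1 / L) * ip (F x - F y) (F x - F y) \<le> ip (F x - F y) (x - y)"
    using assms(3) inner_product_nonneg[OF assms(1), of "F x - F y"]
    unfolding cocoercive_def induced_norm_def by (metis real_sqrt_pow2)
  with \<open>L > 0\<close> show ?thesis
    by (simp add: field_simps)
qed

text \<open>Expanding the square, the cross term is at least twice the quadratic term, by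
  cocoercivity at \<open>x\<close> and \<open>z\<close>.\<close>

lemma step_decreases_distance:
  assumes ip: "inner_product_on_Rd ip" and L: "L > 0"
    and coco: "cocoercive ip (1 / L) F" and zero: "F z = 0"
  shows "L\<^sup>2 * ip (x - (1 / L) *\<^sub>R F x - z) (x - (1 / L) *\<^sub>R F x - z)
    \<le> L\<^sup>2 * ip (x - z) (x - z) - ip (F x) (F x)"
proof -
  have cross: "ip (F x) (F x) \<le> L * ip (F x) (x - z)"
    using cocoerciveD[OF ip L coco, of x z] zero by simp
  have "x - (1 / L) *\<^sub>R F x - z = (x - z) - (1 / L) *\<^sub>R F x"
    by simp
  then have "L\<^sup>2 * ip (x - (1 / L) *\<^sub>R F x - z) (x - (1 / L) *\<^sub>R F x - z)
      = L\<^sup>2 * ip (x - z) (x - z) - 2 * (L * ip (F x) (x - z)) + ip (F x) (F x)"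
    using L by (simp only: inner_product_diff_scaleR_self[OF ip])
      (simp add: field_simps power2_eq_square)
  with cross show ?thesis
    by linarith
qed

text \<open>The displacement is \<open>- F x / L\<close>, so cocoercivity between \<open>x\<close> and its successor \<open>y\<close> says
  that \<open>d = F x - F y\<close> satisfies \<open>\<parallel>d\<parallel>\<^sup>2 \<le> ip d (F x)\<close>; this bounds \<open>\<parallel>F y\<parallel>\<^sup>2 = \<parallel>F x - d\<parallel>\<^sup>2\<close>.\<close>

lemma step_residual_antimono:
  assumes ip: "inner_product_on_Rd ip" and L: "L > 0"
    and coco: "cocoercive ip (1 / L) F" and y: "y = x - (1 / L) *\<^sub>R F x"
  shows "ip (F y) (F y) \<le> ip (F x) (F x)"
proof -
  define d where "d = F x - F y"
  have bil: "bilinear ip"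
    using ip by (simp add: inner_product_on_Rd_def)
  have "ip d d \<le> L * ip d (x - y)"
    using cocoerciveD[OF ip L coco, of x y] by (simp add: d_def)
  also have "\<dots> = ip d (F x)"
    using L by (simp add: y bilinear_rmul[OF bil])
  finally have cross: "ip d d \<le> ip d (F x)" .
  have "ip (F y) (F y) = ip (F x) (F x) - 2 * ip d (F x) + ip d d"
    using inner_product_diff_scaleR_self[OF ip, of "F x" 1 d] by (simp add: d_def)
  with cross inner_product_nonneg[OF ip, of d] show ?thesis
    by linarith
qed

lemma potential_bound:
  assumes ip: "inner_product_on_Rd ip" and L: "L > 0"
    and coco: "cocoercive ip (1 / L) F" and zero: "F z = 0"
    and step: "\<And>k. u (Suc k) = u k - (1 / L) *\<^sub>R F (u k)"
  shows "real k * ip (F (u k)) (F (u k)) + L\<^sup>2 * ip (u k - z) (u k - z)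
    \<le> L\<^sup>2 * ip (u 0 - z) (u 0 - z)"
proof (induction k)
  case 0
  show ?case by simp
next
  case (Suc k)
  have "real (Suc k) * ip (F (u (Suc k))) (F (u (Suc k)))
      \<le> real (Suc k) * ip (F (u k)) (F (u k))"
    by (intro mult_left_mono step_residual_antimono[OF ip L coco step]) simp
  moreover have "L\<^sup>2 * ip (u (Suc k) - z) (u (Suc k) - z)
      \<le> L\<^sup>2 * ip (u k - z) (u k - z) - ip (F (u k)) (F (u k))"
    unfolding step by (rule step_decreases_distance[OF ip L coco zero])
  ultimately show ?case
    using Suc.IH by (simp add: algebra_simps)
qed

theorem lemma3p1:
  fixes ip :: "real ^ 'd \<Rightarrow> real ^ 'd \<Rightarrow> real"
    and F :: "real ^ 'd \<Rightarrow> real ^ 'd"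
    and L :: real
    and ustar :: "real ^ 'd"
    and u :: "nat \<Rightarrow> real ^ 'd"
  assumes "inner_product_on_Rd ip"
    and "L > 0"
    and "cocoercive ip (1 / L) F"
    and "F ustar = 0"
    and "\<And>k. u (Suc k) = u k - (1 / L) *\<^sub>R F (u k)"
  shows "\<forall>k\<ge>1. induced_norm ip (F (u k)) \<le> L * induced_norm ip (u 0 - ustar) / sqrt (real k / 2 + 1)"
proof (intro allI impI)
  fix k :: nat
  let ?f = "ip (F (u k)) (F (u k))" and ?D = "ip (u 0 - ustar) (u 0 - ustar)"
  note nonneg = inner_product_nonneg[OF assms(1)]
  have "?f \<le> L\<^sup>2 * ip (u k - ustar) (u k - ustar)"
    \<comment> \<open>The distance after one further step is still nonnegative.\<close>
    using step_decreases_distance[OF assms(1-4), of "u k"]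
      mult_nonneg_nonneg[OF zero_le_power2[of L] nonneg[of "u k - (1 / L) *\<^sub>R F (u k) - ustar"]]
    by linarith
  moreover have "real k * ?f + L\<^sup>2 * ip (u k - ustar) (u k - ustar) \<le> L\<^sup>2 * ?D"
    by (rule potential_bound[where u = u and k = k, OF assms])
  ultimately have "(real k + 1) * ?f \<le> L\<^sup>2 * ?D"
    by (simp add: algebra_simps)
  moreover have "(real k / 2 + 1) * ?f \<le> (real k + 1) * ?f"
    using nonneg by (intro mult_right_mono) auto
  ultimately have "sqrt (?f * (real k / 2 + 1)) \<le> sqrt (L\<^sup>2 * ?D)"
    by (simp add: mult.commute)
  then have "sqrt ?f * sqrt (real k / 2 + 1) \<le> L * sqrt ?D"
    using assms(2) by (simp only: real_sqrt_mult real_sqrt_abs abs_of_pos)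
  then show "induced_norm ip (F (u k))
      \<le> L * induced_norm ip (u 0 - ustar) / sqrt (real k / 2 + 1)"
    by (simp add: induced_norm_def pos_le_divide_eq add_nonneg_pos)
qed

end
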